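(* Let $G$ be a graph. Then for every natural number $r$, $$p(S_G,r)=\sum_{H\in\mathcal{H}_r(G)}\mathbf{w}(H),$$ where $\mathcal{H}_r(G)$ denotes the set of all TU-subgraphs of $G$ with $r$ edges.
   Context: All graphs are finite, undirected, without loops or multiple edges. The subdivision graph $S_G$ of $G$ is obtained by inserting into each edge $e=\{u,v\}$ of $G$ a new vertex of degree $2$, replacing $e$ by two edges joining the new vertex to $u$ and to $v$. $p(G,r)$ is the number of $r$-matchings (sets of $r$ pairwise disjoint edges) of $G$, with $p(G,0)=1$. A TU-subgraph of $G$ is a subgraph whose connected components are trees or unicyclic graphs (connected graphs with exactly one cycle); TU-subgraphs with $r$ edges are identified with their edge sets (i.e. taken as edge-induced subgraphs, isolated vertices being irrelevant since they contribute a factor $1$ below). If a TU-subgraph $H$ consists of $c$ unicyclic components and tree components $T_1,\ldots,T_t$, its weight is $\mathbf{w}(H)=2^c\prod_{i=1}^t|V(T_i)|$. *)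

theory Defs
  imports Main
begin

record 'a ugraph =
  verts :: "'a set"
  edges :: "'a set set"

definition simple_graph :: "'a ugraph \<Rightarrow> bool" where
  "simple_graph G \<longleftrightarrow> finite (verts G) \<and> (\<forall>e\<in>edges G. e \<subseteq> verts G \<and> card e = 2)"

definition subgraph_of :: "'a ugraph \<Rightarrow> 'a ugraph \<Rightarrow> bool" where
  "subgraph_of H G \<longleftrightarrow> simple_graph H \<and> verts H \<subseteq> verts G \<and> edges H \<subseteq> edges G"

definition induced_subgraph :: "'a ugraph \<Rightarrow> 'a set \<Rightarrow> 'a ugraph" where
  "induced_subgraph G U = \<lparr>verts = U, edges = {e \<in> edges G. e \<subseteq> U}\<rparr>"

definition adjacent :: "'a ugraph \<Rightarrow> 'a \<Rightarrow> 'a \<Rightarrow> bool" where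
  "adjacent G u v \<longleftrightarrow> {u, v} \<in> edges G"

definition connected_graph :: "'a ugraph \<Rightarrow> bool" where
  "connected_graph G \<longleftrightarrow>
     verts G \<noteq> {} \<and> (\<forall>u\<in>verts G. \<forall>v\<in>verts G. (adjacent G)\<^sup>*\<^sup>* u v)"

definition graph_components :: "'a ugraph \<Rightarrow> 'a ugraph set" where
  "graph_components G =
     {induced_subgraph G {w \<in> verts G. (adjacent G)\<^sup>*\<^sup>* v w} | v. v \<in> verts G}"

text \<open>A cycle is identified with its edge set, so that its starting vertex and its orientation
  are immaterial when cycles are counted.\<close>

definition cycle_edges :: "'a list \<Rightarrow> 'a set set" where
  "cycle_edges xs = {{xs ! i, xs ! (Suc i mod length xs)} | i. i < length xs}"

definition graph_cycles :: "'a ugraph \<Rightarrow> 'a set set set" where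
  "graph_cycles G =
     {cycle_edges xs | xs. 3 \<le> length xs \<and> distinct xs \<and> cycle_edges xs \<subseteq> edges G}"

definition tree_graph :: "'a ugraph \<Rightarrow> bool" where
  "tree_graph G \<longleftrightarrow> connected_graph G \<and> graph_cycles G = {}"

definition unicyclic_graph :: "'a ugraph \<Rightarrow> bool" where
  "unicyclic_graph G \<longleftrightarrow> connected_graph G \<and> (\<exists>!C. C \<in> graph_cycles G)"

text \<open>The new vertex inserted into the edge \<open>e\<close> is \<open>Inr e\<close>.\<close>

definition subdivision_graph :: "'a ugraph \<Rightarrow> ('a + 'a set) ugraph" where
  "subdivision_graph G =
     \<lparr>verts = Inl ` verts G \<union> Inr ` edges G,
      edges = {{Inl v, Inr e} | v e. e \<in> edges G \<and> v \<in> e}\<rparr>"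

lemma simple_graph_subdivision_graph:
  assumes "simple_graph G"
  shows "simple_graph (subdivision_graph G)"
proof -
  have "edges G \<subseteq> Pow (verts G)"
    using assms by (auto simp: simple_graph_def)
  then have "finite (edges G)"
    using assms by (auto simp: simple_graph_def intro: finite_subset)
  then show ?thesis
    using assms by (auto simp: simple_graph_def subdivision_graph_def)
qed

definition matchings :: "'a ugraph \<Rightarrow> nat \<Rightarrow> 'a set set set" where
  "matchings G r = {M. M \<subseteq> edges G \<and> card M = r \<and> pairwise disjnt M}"

definition matching_count :: "'a ugraph \<Rightarrow> nat \<Rightarrow> nat" where
  "matching_count G r = card (matchings G r)"

definition TU_graph :: "'a ugraph \<Rightarrow> bool" where
  "TU_graph H \<longleftrightarrow> (\<forall>C\<in>graph_components H. tree_graph C \<or> unicyclic_graph C)"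

text \<open>The condition \<open>verts H = \<Union> (edges H)\<close> says that \<open>H\<close> is edge-induced,
  that is, has no isolated vertices; such a subgraph is determined by its edge set.\<close>

definition TU_subgraphs :: "'a ugraph \<Rightarrow> nat \<Rightarrow> 'a ugraph set" where
  "TU_subgraphs G r =
     {H. subgraph_of H G \<and> verts H = \<Union> (edges H) \<and> card (edges H) = r \<and> TU_graph H}"

definition TU_weight :: "'a ugraph \<Rightarrow> nat" where
  "TU_weight H =
     2 ^ card {C \<in> graph_components H. unicyclic_graph C} *
     (\<Prod>T\<in>{T \<in> graph_components H. tree_graph T}. card (verts T))"

end

theory Submission
  imports Defs "HOL-Library.FuncSet"
begin

text \<open>An \<open>r\<close>-matching of the subdivision is an \<open>r\<close>-set of edges \<open>E\<close> of \<open>G\<close> together with an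
  injective choice of an endpoint of every edge in \<open>E\<close>. The number of such choices is
  multiplicative over the components of the graph spanned by \<open>E\<close>. In a tree a choice misses exactly
  one vertex, and for each missed vertex \<open>u\<close> the choice is forced: orient all edges away from the
  root \<open>u\<close>. In a unicyclic graph, deleting a cycle edge leaves a tree, and the endpoint chosen for
  the deleted edge is the vertex missed in that tree, which gives two choices. A connected graph
  with two cycles has more edges than vertices, hence no injective choice.\<close>

section \<open>Edge deletion and reachability in simple graphs\<close>

abbreviation del_edge :: "'a ugraph \<Rightarrow> 'a set \<Rightarrow> 'a ugraph" where
  "del_edge G e \<equiv> \<lparr>verts = verts G, edges = edges G - {e}\<rparr>"

lemma adjacent_sym: "adjacent G u v \<Longrightarrow> adjacent G v u"
  by (simp add: adjacent_def insert_commute)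

lemma reachable_sym: "(adjacent G)\<^sup>*\<^sup>* u v \<Longrightarrow> (adjacent G)\<^sup>*\<^sup>* v u"
  by (induction rule: rtranclp_induct) (auto intro: adjacent_sym converse_rtranclp_into_rtranclp)

lemma simple_graph_finite_edges: "simple_graph G \<Longrightarrow> finite (edges G)"
  by (rule finite_subset[of _ "Pow (verts G)"]) (auto simp: simple_graph_def)

lemma simple_graph_adjacentD:
  assumes "simple_graph G" "adjacent G u v"
  shows "u \<in> verts G" "v \<in> verts G" "u \<noteq> v"
  using assms by (force simp: simple_graph_def adjacent_def)+

lemma simple_graph_edgeE:
  assumes "simple_graph G" "e \<in> edges G"
  obtains a b where "e = {a, b}" "a \<noteq> b" "a \<in> verts G" "b \<in> verts G"
  using assms by (metis simple_graph_def card_2_iff insert_subset)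

lemma reachable_verts:
  assumes "simple_graph G" "(adjacent G)\<^sup>*\<^sup>* u v" "u \<in> verts G"
  shows "v \<in> verts G"
  using assms(2,3) by (induction rule: rtranclp_induct) (auto dest: simple_graph_adjacentD[OF assms(1)])

section \<open>Connected graphs\<close>

text \<open>Breadth-first search from \<open>u\<close>: \<open>d\<close> is the distance from
  \<open>u\<close>, and \<open>q w\<close> is the last vertex before \<open>w\<close> on a shortest
  walk from \<open>u\<close> to \<open>w\<close>. The strict decrease of \<open>d\<close> serves as
  the induction measure later on.\<close>

lemma connected_parent_map:
  assumes "simple_graph G" "connected_graph G" "u \<in> verts G"
  obtains q :: "'a \<Rightarrow> 'a" and d :: "'a \<Rightarrow> nat"
    where "\<And>w. w \<in> verts G - {u} \<Longrightarrow> q w \<in> verts G \<and> {w, q w} \<in> edges G \<and> d (q w) < d w"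
proof -
  define d where "d w = (LEAST n. (adjacent G ^^ n) u w)" for w
  have "\<exists>x. x \<in> verts G \<and> {w, x} \<in> edges G \<and> d x < d w" if w: "w \<in> verts G - {u}" for w
  proof -
    have "(adjacent G)\<^sup>*\<^sup>* u w"
      using assms w by (simp add: connected_graph_def)
    then obtain n where "(adjacent G ^^ n) u w"
      by (auto dest: rtranclp_imp_relpowp)
    then have dw: "(adjacent G ^^ d w) u w"
      unfolding d_def by (rule LeastI)
    moreover have "d w \<noteq> 0"
      using dw w by (metis relpowp_0_E DiffE singletonI)
    ultimately obtain m where m: "d w = Suc m" "(adjacent G ^^ Suc m) u w"
      by (metis not0_implies_Suc)
    then obtain x where x: "(adjacent G ^^ m) u x" "adjacent G x w"
      by (auto elim: relpowp_Suc_E)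
    have "d x \<le> m"
      unfolding d_def using x(1) by (rule Least_le)
    then show ?thesis
      using x(2) m(1) simple_graph_adjacentD(1)[OF assms(1) x(2)]
      by (auto simp: adjacent_def insert_commute)
  qed
  then obtain q where "\<And>w. w \<in> verts G - {u} \<Longrightarrow> q w \<in> verts G \<and> {w, q w} \<in> edges G \<and> d (q w) < d w"
    by metis
  then show thesis by (rule that)
qed

text \<open>Two different vertices with the same parent edge would be each other's parents, so each
  would have smaller \<open>d\<close> than the other.\<close>

lemma parent_edges_inj:
  fixes d :: "'a \<Rightarrow> nat"
  assumes "\<And>w. w \<in> W \<Longrightarrow> d (q w) < d w"
  shows "inj_on (\<lambda>w. {w, q w}) W"
proof (rule inj_onI)
  fix x y assume "x \<in> W" "y \<in> W" "{x, q x} = {y, q y}"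
  then show "x = y"
    using assms[of x] assms[of y] by (fastforce simp: doubleton_eq_iff)
qed

text \<open>Sending each vertex other than a root to its parent edge is an injection into the
  edges.\<close>

lemma connected_card_verts_le:
  assumes "simple_graph G" "connected_graph G"
  shows "card (verts G) \<le> Suc (card (edges G))"
proof -
  from assms obtain u where u: "u \<in> verts G"
    by (auto simp: connected_graph_def)
  obtain q and d :: "'a \<Rightarrow> nat"
    where q: "\<And>w. w \<in> verts G - {u} \<Longrightarrow> q w \<in> verts G \<and> {w, q w} \<in> edges G \<and> d (q w) < d w"
    using connected_parent_map[OF assms u] by metis
  have "card (verts G - {u}) \<le> card (edges G)"
    by (rule card_inj_on_le[where f = "\<lambda>w. {w, q w}"])
      (use q simple_graph_finite_edges[OF assms(1)] in \<open>auto intro: parent_edges_inj[of _ d]\<close>)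
  then show ?thesis
    using u assms(1) by (simp add: simple_graph_def card_Diff_singleton_if)
qed

section \<open>Paths, cycles and the edge count of a tree\<close>

lemma reachable_distinct_path:
  assumes "(adjacent G)\<^sup>*\<^sup>* a b"
  shows "\<exists>xs. xs \<noteq> [] \<and> hd xs = a \<and> last xs = b \<and> distinct xs \<and> successively (adjacent G) xs"
  using assms
proof (induction rule: rtranclp_induct)
  case base
  show ?case by (rule exI[of _ "[a]"]) simp
next
  case (step y z)
  then obtain xs where xs: "xs \<noteq> []" "hd xs = a" "last xs = y" "distinct xs"
    "successively (adjacent G) xs" by blast
  show ?case
  proof (cases "z \<in> set xs")
    \<comment> \<open>When the new endpoint \<open>z\<close> already lies on the path, the path is
      cut off at \<open>z\<close> instead of being extended.\<close>
    case True
    then obtain ys zs where "xs = (ys @ [z]) @ zs"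
      by (metis split_list append.assoc append_Cons append_Nil)
    then show ?thesis
      using xs by (intro exI[of _ "ys @ [z]"]) (auto simp: successively_append_iff hd_append split: if_splits)
  next
    case False
    then show ?thesis
      using xs step.hyps(2) by (intro exI[of _ "xs @ [z]"]) (auto simp: successively_append_iff)
  qed
qed

text \<open>The one index pair that wraps around modulo the length is the closing edge; all other
  pairs are consecutive on the path.\<close>

lemma path_closing_edge_cycle:
  assumes "distinct xs" "3 \<le> length xs" "successively (adjacent G) xs" "{last xs, hd xs} \<in> edges G"
  shows "cycle_edges xs \<in> graph_cycles G"
proof -
  have "{xs ! i, xs ! (Suc i mod length xs)} \<in> edges G" if "i < length xs" for i
  proof (cases "Suc i = length xs")
    case True
    then have "last xs = xs ! i" "hd xs = xs ! 0"
      by (metis last_conv_nth diff_Suc_1 length_0_conv nat.distinct(1), metis hd_conv_nth length_0_conv nat.distinct(1))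
    then show ?thesis using assms(4) True by simp
  next
    case False
    then show ?thesis
      using assms(3) that by (auto simp: successively_conv_nth adjacent_def)
  qed
  then show ?thesis
    using assms(1,2) by (auto simp: graph_cycles_def cycle_edges_def)
qed

lemma tree_card_verts:
  assumes "simple_graph G" "tree_graph G"
  shows "card (verts G) = Suc (card (edges G))"
proof -
  have conn: "connected_graph G" and acyc: "graph_cycles G = {}"
    using assms(2) by (auto simp: tree_graph_def)
  from conn obtain u where u: "u \<in> verts G"
    by (auto simp: connected_graph_def)
  obtain q and d :: "'a \<Rightarrow> nat"
    where q: "\<And>w. w \<in> verts G - {u} \<Longrightarrow> q w \<in> verts G \<and> {w, q w} \<in> edges G \<and> d (q w) < d w"
    using connected_parent_map[OF assms(1) conn u] by metis
  \<comment> \<open>The parent edges connect everything to \<open>u\<close>, so any further edge would close a cycle.\<close>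
  define F where "F = (\<lambda>w. {w, q w}) ` (verts G - {u})"
  define T where "T = \<lparr>verts = verts G, edges = F\<rparr>"
  have FE: "F \<subseteq> edges G" using q by (auto simp: F_def)
  have to_root: "(adjacent T)\<^sup>*\<^sup>* w u" if "w \<in> verts G" for w
    using that
  proof (induction "d w" arbitrary: w rule: less_induct)
    case less
    show ?case
    proof (cases "w = u")
      case False
      then have w: "w \<in> verts G - {u}" using less.prems by simp
      then have "adjacent T w (q w)" by (auto simp: T_def F_def adjacent_def)
      moreover have "(adjacent T)\<^sup>*\<^sup>* (q w) u" using less.hyps q[OF w] by blast
      ultimately show ?thesis by (rule converse_rtranclp_into_rtranclp)
    qed simp
  qed
  have "edges G \<subseteq> F"
  proof
    fix e assume e: "e \<in> edges G"
    obtain a b where ab: "e = {a, b}" "a \<noteq> b" "a \<in> verts G" "b \<in> verts G"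
      using simple_graph_edgeE[OF assms(1) e] .
    have "(adjacent T)\<^sup>*\<^sup>* a b"
      using to_root ab reachable_sym rtranclp_trans by metis
    then obtain xs where xs: "xs \<noteq> []" "hd xs = a" "last xs = b" "distinct xs"
      "successively (adjacent T) xs"
      using reachable_distinct_path by metis
    show "e \<in> F"
    proof (rule ccontr)
      assume "e \<notin> F"
      \<comment> \<open>Length 1 would give \<open>a = b\<close>, and length 2 would make
        \<open>e\<close> itself a parent edge. So the path has the three vertices that a cycle
        requires.\<close>
      have "length xs \<noteq> 1" using xs ab by (auto simp: length_Suc_conv)
      moreover have "length xs \<noteq> 2"
        using xs ab \<open>e \<notin> F\<close> by (auto simp: length_Suc_conv numeral_2_eq_2 adjacent_def T_def)
      moreover have "length xs \<noteq> 0" using xs by simp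
      ultimately have "3 \<le> length xs" by linarith
      moreover have "successively (adjacent G) xs"
        by (rule successively_mono[OF xs(5)]) (use FE in \<open>auto simp: adjacent_def T_def\<close>)
      ultimately have "cycle_edges xs \<in> graph_cycles G"
        using xs ab e by (intro path_closing_edge_cycle) (auto simp: insert_commute)
      then show False using acyc by simp
    qed
  qed
  then have "card (edges G) = card (verts G - {u})"
    using FE q unfolding F_def by (subst card_image[symmetric]) (auto intro: parent_edges_inj[of _ d])
  then show ?thesis
    using u assms(1) card_Suc_Diff1[of "verts G" u] by (simp add: simple_graph_def)
qed

section \<open>Deleting edges of cycles\<close>

lemma cycle_endpoints_reachable:
  assumes "3 \<le> length xs" "distinct xs" "cycle_edges xs \<subseteq> edges G" "i < length xs"
    and "e = {xs ! i, xs ! (Suc i mod length xs)}"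
  shows "(adjacent (del_edge G e))\<^sup>*\<^sup>* (xs ! (Suc i mod length xs)) (xs ! i)"
proof -
  let ?n = "length xs"
  have n0: "\<And>k. k mod ?n < ?n" using assms(1) by (intro mod_less_divisor) auto
  \<comment> \<open>The walk goes the long way round the cycle, starting at the far end of
    \<open>e\<close>. It stops after at most \<open>?n - 1\<close> steps, since step
    \<open>?n\<close> would traverse \<open>e\<close>; at exactly \<open>?n - 1\<close> steps it is
    at index \<open>i\<close>.\<close>
  have "(adjacent (del_edge G e))\<^sup>*\<^sup>* (xs ! (Suc i mod ?n)) (xs ! ((Suc i + j) mod ?n))" if "j < ?n" for j
    using that
  proof (induction j)
    case (Suc j)
    let ?k = "(Suc i + j) mod ?n"
    have sk: "Suc ?k mod ?n = (Suc i + Suc j) mod ?n" by (simp add: mod_Suc_eq)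
    have "{xs ! ?k, xs ! (Suc ?k mod ?n)} \<in> cycle_edges xs"
      unfolding cycle_edges_def using n0[of "Suc i + j"] by blast
    then have "{xs ! ?k, xs ! (Suc ?k mod ?n)} \<in> edges G"
      using assms(3) by blast
    \<comment> \<open>Since \<open>xs\<close> is distinct, an equal edge has either the same
      starting index, so that \<open>?n\<close> divides \<open>Suc j < ?n\<close>, or is
      \<open>e\<close> read backwards, so that \<open>?n\<close> divides 2; both contradict the
      bounds.\<close>
    moreover have "{xs ! ?k, xs ! (Suc ?k mod ?n)} \<noteq> e"
    proof
      assume "{xs ! ?k, xs ! (Suc ?k mod ?n)} = e"
      then have "xs ! ?k = xs ! i \<or> xs ! ?k = xs ! (Suc i mod ?n) \<and> xs ! (Suc ?k mod ?n) = xs ! i"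
        unfolding assms(5) doubleton_eq_iff by blast
      then have "?k = i \<or> ?k = Suc i mod ?n \<and> Suc ?k mod ?n = i"
        using nth_eq_iff_index_eq[OF assms(2)] n0 assms(4) by metis
      then show False
      proof
        assume "?k = i"
        then have "(i + Suc j) mod ?n = (i + 0) mod ?n" using assms(4) by simp
        then have "?n dvd Suc j"
          using mod_eq_dvd_iff_nat[of i "i + Suc j" ?n] by simp
        then show False using Suc.prems by (auto dest: dvd_imp_le)
      next
        assume *: "?k = Suc i mod ?n \<and> Suc ?k mod ?n = i"
        then have "(i + 2) mod ?n = i mod ?n"
          using assms(4) by (metis mod_Suc_eq mod_less add_2_eq_Suc')
        then have "?n dvd 2"
          using mod_eq_dvd_iff_nat[of i "i + 2" ?n] by simp
        then show False using assms(1) by (auto dest: dvd_imp_le)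
      qed
    qed
    ultimately have "adjacent (del_edge G e) (xs ! ?k) (xs ! ((Suc i + Suc j) mod ?n))"
      by (simp only: adjacent_def sk) simp
    then show ?case using Suc by (meson Suc_lessD rtranclp.rtrancl_into_rtrancl)
  qed simp
  moreover have "Suc i + (?n - 1) = i + ?n" "?n - 1 < ?n"
    using assms(4) by linarith+
  ultimately show ?thesis using assms(4) by (metis mod_add_self2 mod_less)
qed

text \<open>Every use of \<open>e\<close> in a walk can be replaced by the detour along the rest of
  the cycle.\<close>

lemma connected_del_cycle_edge:
  assumes "connected_graph G" "C \<in> graph_cycles G" "e \<in> C"
  shows "connected_graph (del_edge G e)"
proof -
  let ?R = "(adjacent (del_edge G e))\<^sup>*\<^sup>*"
  obtain xs where xs: "3 \<le> length xs" "distinct xs" "cycle_edges xs \<subseteq> edges G" "C = cycle_edges xs"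
    using assms(2) by (auto simp: graph_cycles_def)
  then obtain i where i: "i < length xs" "e = {xs ! i, xs ! (Suc i mod length xs)}"
    using assms(3) by (auto simp: cycle_edges_def)
  obtain a b where ab: "e = {a, b}" "?R a b"
    using cycle_endpoints_reachable[OF xs(1-3) i] i by (metis insert_commute)
  have step: "?R x y" if "adjacent G x y" for x y
  proof (cases "{x, y} = e")
    case True
    then show ?thesis using ab reachable_sym[OF ab(2)] by (auto simp: doubleton_eq_iff)
  next
    case False
    then show ?thesis using that by (auto simp: adjacent_def)
  qed
  have "?R x y" if "(adjacent G)\<^sup>*\<^sup>* x y" for x y
    using that by (induction rule: rtranclp_induct) (auto dest: step)
  then show ?thesis using assms(1) by (auto simp: connected_graph_def)
qed

lemma cycle_nonempty: "C \<in> graph_cycles G \<Longrightarrow> C \<noteq> {}"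
  by (force simp: graph_cycles_def cycle_edges_def)

lemma cycle_subset_edges: "C \<in> graph_cycles G \<Longrightarrow> C \<subseteq> edges G"
  by (auto simp: graph_cycles_def)

lemma graph_cycles_del_edge:
  "graph_cycles (del_edge G e) = {C \<in> graph_cycles G. e \<notin> C}"
  by (auto simp: graph_cycles_def)

text \<open>Two edges can be deleted in succession without losing connectedness, and the remaining
  graph still has at least |V| - 1 edges.\<close>

lemma two_cycles_card_edges:
  assumes "simple_graph G" "connected_graph G"
    and "C \<in> graph_cycles G" "D \<in> graph_cycles G" "C \<noteq> D"
  shows "card (verts G) < card (edges G)"
proof -
  \<comment> \<open>Of two different edge sets, one has an element outside the other;
    \<open>A\<close> and \<open>B\<close> are \<open>C\<close> and \<open>D\<close> in the suitable
    order. The cycle \<open>B\<close> survives the deletion of \<open>e\<close>, so it can supply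
    the second edge.\<close>
  obtain A B e where AB: "A \<in> graph_cycles G" "B \<in> graph_cycles G" "e \<in> A" "e \<notin> B"
    using assms(3-5) by blast
  obtain e' where e': "e' \<in> B" using cycle_nonempty[OF AB(2)] by blast
  let ?G1 = "del_edge G e"
  let ?G2 = "del_edge ?G1 e'"
  have "connected_graph ?G1"
    using connected_del_cycle_edge[OF assms(2) AB(1,3)] .
  then have "connected_graph ?G2"
    using AB e' by (intro connected_del_cycle_edge[of ?G1 B]) (auto simp: graph_cycles_del_edge)
  moreover have "simple_graph ?G2"
    using assms(1) by (auto simp: simple_graph_def)
  ultimately have "card (verts G) \<le> Suc (card (edges G - {e} - {e'}))"
    using connected_card_verts_le[of ?G2] by simp
  moreover have "e \<in> edges G" "e' \<in> edges G - {e}"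
    using AB e' cycle_subset_edges by blast+
  ultimately show ?thesis
    using simple_graph_finite_edges[OF assms(1)]
    by (metis card_Suc_Diff1 finite_Diff le_imp_less_Suc not_less_eq)
qed

section \<open>Injective choice functions\<close>

text \<open>Systems of distinct representatives of the family \<open>E\<close>. The extensional
  product fixes the values outside \<open>E\<close>, so that functions are counted by their values
  on \<open>E\<close> only.\<close>

definition sdrs :: "'a set set \<Rightarrow> ('a set \<Rightarrow> 'a) set" where
  "sdrs E = {f \<in> (\<Pi>\<^sub>E e\<in>E. e). inj_on f E}"

lemma finite_sdrs:
  assumes "simple_graph G" "E \<subseteq> edges G"
  shows "finite (sdrs E)"
proof -
  have "finite E"
    using assms simple_graph_finite_edges finite_subset by blast
  moreover have "finite e" if "e \<in> E" for e
    using assms that by (metis card.infinite in_mono simple_graph_def zero_neq_numeral)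
  ultimately have "finite (\<Pi>\<^sub>E e\<in>E. e)"
    by (intro finite_PiE) auto
  then show ?thesis by (simp add: sdrs_def)
qed

lemma sdrs_image_subset: "f \<in> sdrs E \<Longrightarrow> f ` E \<subseteq> \<Union> E"
  by (auto simp: sdrs_def PiE_def Pi_def)

text \<open>The edge count makes the parent map \<open>w \<mapsto> {w, q w}\<close> a bijection from
  the vertices other than \<open>u\<close> onto the edges. Its inverse is the only choice that
  avoids \<open>u\<close>: every edge selects its endpoint farther from \<open>u\<close>.\<close>

lemma card_sdrs_missing_root:
  assumes "simple_graph G" "connected_graph G" "card (verts G) = Suc (card (edges G))" "u \<in> verts G"
  shows "card {f \<in> sdrs (edges G). u \<notin> f ` edges G} = 1"
proof -
  obtain q and d :: "'a \<Rightarrow> nat"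
    where q: "\<And>w. w \<in> verts G - {u} \<Longrightarrow> q w \<in> verts G \<and> {w, q w} \<in> edges G \<and> d (q w) < d w"
    using connected_parent_map[OF assms(1,2,4)] by metis
  let ?p = "\<lambda>w. {w, q w}"
  have inj: "inj_on ?p (verts G - {u})"
    using q by (intro parent_edges_inj[of _ d]) auto
  have "card (?p ` (verts G - {u})) = card (edges G)"
    using assms by (simp add: card_image[OF inj] simple_graph_def)
  then have surj: "?p ` (verts G - {u}) = edges G"
    using q simple_graph_finite_edges[OF assms(1)] by (intro card_subset_eq) auto
  define g where "g = restrict (inv_into (verts G - {u}) ?p) (edges G)"
  have gp: "g (?p w) = w" if "w \<in> verts G - {u}" for w
    using that q inv_into_f_f[OF inj that] by (simp add: g_def)
  have "g \<in> sdrs (edges G)"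
    unfolding sdrs_def
  proof (intro CollectI conjI)
    show "g \<in> (\<Pi>\<^sub>E e\<in>edges G. e)"
    proof (rule PiE_I)
      fix e assume "e \<in> edges G"
      then obtain w where "w \<in> verts G - {u}" "e = ?p w" using surj by blast
      then show "g e \<in> e" using gp by simp
    qed (simp add: g_def)
    show "inj_on g (edges G)"
      unfolding surj[symmetric] by (rule inj_onI) (use gp in force)
  qed
  moreover have "u \<notin> g ` edges G"
    unfolding surj[symmetric] using gp by force
  moreover have "f = g" if f: "f \<in> sdrs (edges G)" "u \<notin> f ` edges G" for f
  proof -
    have fw: "f (?p w) = w" if "w \<in> verts G - {u}" for w
      using that
    proof (induction "d w" arbitrary: w rule: less_induct)
      case less
      note w = q[OF less.prems]
      have mem: "f (?p w) \<in> ?p w" and ne: "f (?p w) \<noteq> u"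
        using f w by (auto simp: sdrs_def PiE_def Pi_def)
      show ?case
      proof (rule ccontr)
        \<comment> \<open>Otherwise the edge of \<open>w\<close> selects \<open>q w\<close>, which
          is then not the root. By induction the parent edge of \<open>q w\<close> selects
          \<open>q w\<close> as well, and injectivity identifies the two edges.\<close>
        assume "f (?p w) \<noteq> w"
        then have *: "f (?p w) = q w" using mem by simp
        then have qw: "q w \<in> verts G - {u}" using w ne by auto
        then have "f (?p (q w)) = f (?p w)" using less.hyps w * by metis
        then have "?p (q w) = ?p w"
          using f w q[OF qw] by (auto simp: sdrs_def dest: inj_onD)
        then have "q w = w" by (rule inj_onD[OF inj _ qw less.prems])
        then show False using w by simp
      qed
    qed
    have "f e = g e" if "e \<in> edges G" for e
    proof -
      obtain w where "w \<in> verts G - {u}" "e = ?p w" using \<open>e \<in> edges G\<close> surj by blast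
      then show ?thesis using fw gp by metis
    qed
    moreover have "f \<in> extensional (edges G)" "g \<in> extensional (edges G)"
      using f(1) by (simp_all add: sdrs_def PiE_def g_def)
    ultimately show ?thesis by (rule extensionalityI[rotated 2])
  qed
  ultimately have "{f \<in> sdrs (edges G). u \<notin> f ` edges G} = {g}" by blast
  then show ?thesis by simp
qed

text \<open>The image of a choice function has |E| = |V| - 1 vertices. The classes
  \<open>?S u\<close> of functions missing \<open>u\<close> therefore partition
  \<open>sdrs (edges G)\<close>, and each class has one element.\<close>

lemma card_sdrs_tree:
  assumes "simple_graph G" "tree_graph G"
  shows "card (sdrs (edges G)) = card (verts G)"
proof -
  note card_eq = tree_card_verts[OF assms]
  have conn: "connected_graph G" using assms by (simp add: tree_graph_def)
  have finV: "finite (verts G)" using assms by (simp add: simple_graph_def)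
  let ?S = "\<lambda>u. {f \<in> sdrs (edges G). u \<notin> f ` edges G}"
  have one: "card (verts G - f ` edges G) = 1" if "f \<in> sdrs (edges G)" for f
  proof -
    have "f ` edges G \<subseteq> verts G"
      using sdrs_image_subset[OF that] assms(1) by (auto simp: simple_graph_def)
    moreover have "card (f ` edges G) = card (edges G)"
      using that by (simp add: sdrs_def card_image)
    ultimately show ?thesis
      using card_eq finV by (simp add: card_Diff_subset finite_subset)
  qed
  have "sdrs (edges G) = (\<Union>u\<in>verts G. ?S u)"
    using one by (fastforce simp: card_1_singleton_iff)
  moreover have "card (\<Union>u\<in>verts G. ?S u) = (\<Sum>u\<in>verts G. card (?S u))"
  proof (rule card_UN_disjoint)
    show "\<forall>u\<in>verts G. \<forall>v\<in>verts G. u \<noteq> v \<longrightarrow> ?S u \<inter> ?S v = {}"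
    proof (intro ballI impI equals0I)
      fix u v f assume uv: "u \<in> verts G" "v \<in> verts G" "u \<noteq> v" and f: "f \<in> ?S u \<inter> ?S v"
      then have "{u, v} \<subseteq> verts G - f ` edges G" by blast
      then have "card {u, v} \<le> card (verts G - f ` edges G)"
        using finV by (intro card_mono) auto
      then show False using one[of f] f uv(3) by simp
    qed
  qed (use finV finite_sdrs[OF assms(1)] in auto)
  ultimately show ?thesis
    using card_sdrs_missing_root[OF assms(1) conn card_eq] by simp
qed

text \<open>Prescribing the value \<open>a\<close> at \<open>e\<close> amounts to removing
  \<open>e\<close> and forbidding \<open>a\<close> to the other edges.\<close>

lemma card_sdrs_insert:
  assumes "e \<notin> E" "a \<in> e"
  shows "card {f \<in> sdrs (insert e E). f e = a} = card {g \<in> sdrs E. a \<notin> g ` E}"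
proof (rule bij_betw_same_card[symmetric], rule bij_betwI)
  show "(\<lambda>g. g(e := a)) \<in> {g \<in> sdrs E. a \<notin> g ` E} \<rightarrow> {f \<in> sdrs (insert e E). f e = a}"
  proof (intro funcsetI CollectI conjI)
    fix g assume "g \<in> {g \<in> sdrs E. a \<notin> g ` E}"
    then have g: "g \<in> (\<Pi>\<^sub>E e\<in>E. e)" "inj_on g E" "a \<notin> g ` E" by (simp_all add: sdrs_def)
    have "inj_on (g(e := a)) (insert e E)"
      using assms(1) g(2,3) by (auto simp: inj_on_fun_updI)
    then show "g(e := a) \<in> sdrs (insert e E)"
      using PiE_fun_upd[OF assms(2) g(1)] by (simp add: sdrs_def)
  qed simp
  \<comment> \<open>Resetting to \<open>undefined\<close> is what extensionality demands at
    \<open>e\<close>, which lies outside \<open>E\<close>.\<close>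
  show "(\<lambda>f. f(e := undefined)) \<in> {f \<in> sdrs (insert e E). f e = a} \<rightarrow> {g \<in> sdrs E. a \<notin> g ` E}"
  proof (intro funcsetI)
    fix f assume "f \<in> {f \<in> sdrs (insert e E). f e = a}"
    then have f: "f \<in> (\<Pi>\<^sub>E e\<in>insert e E. e)" "inj_on f E" "a \<notin> f ` E"
      using assms(1) by (auto simp: sdrs_def)
    have "inj_on (f(e := undefined)) E"
      using f(2) assms(1) by (subst inj_on_cong[of _ _ f]) auto
    moreover have "a \<notin> (f(e := undefined)) ` E"
      using f(3) assms(1) by auto
    ultimately show "f(e := undefined) \<in> {g \<in> sdrs E. a \<notin> g ` E}"
      using fun_upd_in_PiE[OF assms(1) f(1)] by (simp add: sdrs_def)
  qed
  show "(g(e := a))(e := undefined) = g" if "g \<in> {g \<in> sdrs E. a \<notin> g ` E}" for g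
    using that assms by (auto simp: sdrs_def PiE_def extensional_def fun_eq_iff)
  show "(f(e := undefined))(e := a) = f" if "f \<in> {f \<in> sdrs (insert e E). f e = a}" for f
    using that by auto
qed

lemma card_sdrs_unicyclic:
  assumes "simple_graph G" "unicyclic_graph G"
  shows "card (sdrs (edges G)) = 2"
proof -
  obtain C where C: "C \<in> graph_cycles G" "\<And>D. D \<in> graph_cycles G \<Longrightarrow> D = C"
    using assms(2) by (auto simp: unicyclic_graph_def)
  obtain e where eC: "e \<in> C" using cycle_nonempty[OF C(1)] by blast
  then have e: "e \<in> edges G" using cycle_subset_edges[OF C(1)] by blast
  let ?T = "del_edge G e"
  have sT: "simple_graph ?T" using assms(1) by (auto simp: simple_graph_def)
  have cT: "connected_graph ?T"
    using assms(2) by (intro connected_del_cycle_edge[OF _ C(1) eC]) (simp add: unicyclic_graph_def)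
  have "graph_cycles ?T = {}"
    unfolding graph_cycles_del_edge using C eC by blast
  then have tT: "tree_graph ?T" using cT by (simp add: tree_graph_def)
  obtain a b where ab: "e = {a, b}" "a \<noteq> b" "a \<in> verts G" "b \<in> verts G"
    using simple_graph_edgeE[OF assms(1) e] .
  let ?S = "\<lambda>v. {f \<in> sdrs (edges G). f e = v}"
  \<comment> \<open>Choosing \<open>v\<close> for \<open>e\<close> leaves a choice function on the
    tree \<open>?T\<close> that misses \<open>v\<close>, and there is exactly one.\<close>
  have one: "card (?S v) = 1" if "v \<in> e" for v
  proof -
    have "insert e (edges G - {e}) = edges G" using e by blast
    moreover have "v \<in> verts G" using that ab by blast
    ultimately show ?thesis
      using card_sdrs_insert[of e "edges G - {e}" v] that
        card_sdrs_missing_root[OF sT cT tree_card_verts[OF sT tT], of v] by simp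
  qed
  have "sdrs (edges G) = ?S a \<union> ?S b"
    using e ab(1) by (auto simp: sdrs_def PiE_def Pi_def)
  moreover have "card (?S a \<union> ?S b) = card (?S a) + card (?S b)"
    using finite_sdrs[OF assms(1)] ab(2) by (intro card_Un_disjoint) auto
  ultimately show ?thesis using one ab(1) by simp
qed

text \<open>Being neither acyclic nor unicyclic forces two different cycles, hence more edges than
  vertices, and no injection is possible.\<close>

lemma sdrs_connected_non_TU:
  assumes "simple_graph G" "connected_graph G" "\<not> tree_graph G" "\<not> unicyclic_graph G"
  shows "sdrs (edges G) = {}"
proof (rule ccontr)
  assume "sdrs (edges G) \<noteq> {}"
  then obtain f where f: "f \<in> sdrs (edges G)" by blast
  have "f ` edges G \<subseteq> verts G"
    using sdrs_image_subset[OF f] assms(1) by (auto simp: simple_graph_def)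
  then have "card (edges G) \<le> card (verts G)"
    using f assms(1) by (intro card_inj_on_le[of f]) (auto simp: sdrs_def simple_graph_def)
  moreover obtain C D where "C \<in> graph_cycles G" "D \<in> graph_cycles G" "C \<noteq> D"
    using assms(2-4) by (auto simp: tree_graph_def unicyclic_graph_def)
  ultimately show False
    using two_cycles_card_edges[OF assms(1,2)] by fastforce
qed

section \<open>Multiplicativity over vertex-disjoint edge sets\<close>

lemma sdrs_restrict: "f \<in> sdrs E \<Longrightarrow> A \<subseteq> E \<Longrightarrow> restrict f A \<in> sdrs A"
  by (auto simp: sdrs_def intro: inj_on_subset)

text \<open>Values on \<open>A\<close> and on \<open>B\<close> lie in disjoint vertex sets, so
  gluing two injective choices is again injective and inverts restriction to \<open>A\<close> and
  \<open>B\<close>.\<close>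

lemma card_sdrs_Un:
  assumes "\<Union> A \<inter> \<Union> B = {}" "{} \<notin> A"
  shows "card (sdrs (A \<union> B)) = card (sdrs A) * card (sdrs B)"
proof -
  \<comment> \<open>A common member is nonempty, and any vertex of it would lie in both
    unions.\<close>
  have AB: "A \<inter> B = {}"
  proof (rule equals0I)
    fix e assume e: "e \<in> A \<inter> B"
    then have "e \<noteq> {}" using assms(2) by auto
    then obtain v where "v \<in> e" by blast
    then show False using e assms(1) by blast
  qed
  have sep: "f x \<noteq> g y" if "f \<in> (\<Pi>\<^sub>E e\<in>A. e)" "g \<in> (\<Pi>\<^sub>E e\<in>B. e)" "x \<in> A" "y \<in> B" for f g x y
    using PiE_mem[OF that(1,3)] PiE_mem[OF that(2,4)] that(3,4) assms(1)
    by (metis UnionI disjoint_iff)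
  have "bij_betw (\<lambda>f. (restrict f A, restrict f B)) (sdrs (A \<union> B)) (sdrs A \<times> sdrs B)"
  proof (rule bij_betwI)
    show "(\<lambda>f. (restrict f A, restrict f B)) \<in> sdrs (A \<union> B) \<rightarrow> sdrs A \<times> sdrs B"
      by (auto intro: sdrs_restrict)
    show "(\<lambda>(f, g) e. if e \<in> A then f e else g e) \<in> sdrs A \<times> sdrs B \<rightarrow> sdrs (A \<union> B)"
    proof (clarsimp simp: Pi_iff)
      fix f g assume fg: "f \<in> sdrs A" "g \<in> sdrs B"
      then have "f \<in> (\<Pi>\<^sub>E e\<in>A. e)" "g \<in> (\<Pi>\<^sub>E e\<in>B. e)" by (auto simp: sdrs_def)
      note s = sep[OF this]
      show "(\<lambda>e. if e \<in> A then f e else g e) \<in> sdrs (A \<union> B)"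
        unfolding sdrs_def
      proof (intro CollectI conjI)
        show "(\<lambda>e. if e \<in> A then f e else g e) \<in> (\<Pi>\<^sub>E e\<in>A \<union> B. e)"
          using fg by (auto simp: sdrs_def PiE_def Pi_def extensional_def)
        show "inj_on (\<lambda>e. if e \<in> A then f e else g e) (A \<union> B)"
        proof (rule inj_onI)
          fix x y assume "x \<in> A \<union> B" "y \<in> A \<union> B"
            "(if x \<in> A then f x else g x) = (if y \<in> A then f y else g y)"
          then show "x = y"
            using fg s[of x y] s[of y x] by (auto simp: sdrs_def dest: inj_onD split: if_splits)
        qed
      qed
    qed
    show "(\<lambda>(f, g) e. if e \<in> A then f e else g e) (restrict f A, restrict f B) = f"
      if "f \<in> sdrs (A \<union> B)" for f
      using that by (auto simp: sdrs_def PiE_def extensional_def fun_eq_iff)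
    show "(\<lambda>f. (restrict f A, restrict f B)) ((\<lambda>(f, g) e. if e \<in> A then f e else g e) p) = p"
      if "p \<in> sdrs A \<times> sdrs B" for p
      using that AB by (auto simp: sdrs_def PiE_def extensional_def fun_eq_iff)
  qed
  from bij_betw_same_card[OF this] show ?thesis
    by (simp add: card_cartesian_product)
qed

lemma card_sdrs_UNION:
  assumes "finite I" "pairwise (\<lambda>i j. \<Union> (A i) \<inter> \<Union> (A j) = {}) I" "\<And>i. i \<in> I \<Longrightarrow> {} \<notin> A i"
  shows "card (sdrs (\<Union>i\<in>I. A i)) = (\<Prod>i\<in>I. card (sdrs (A i)))"
  using assms
proof (induction I rule: finite_induct)
  \<comment> \<open>The function that is \<open>undefined\<close> everywhere is the one choice for
    no edges, matching the empty product 1.\<close>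
  case empty
  then show ?case by (simp add: sdrs_def)
next
  case (insert i I)
  have "\<Union> (A i) \<inter> \<Union> (\<Union>j\<in>I. A j) = {}"
    using insert.prems(1) insert.hyps(2) unfolding pairwise_insert by blast
  then have "card (sdrs (A i \<union> (\<Union>j\<in>I. A j))) = card (sdrs (A i)) * card (sdrs (\<Union>j\<in>I. A j))"
    using insert.prems(2) by (intro card_sdrs_Un) auto
  then show ?case
    using insert by (simp add: pairwise_insert)
qed

section \<open>Components\<close>

lemma finite_graph_components: "simple_graph H \<Longrightarrow> finite (graph_components H)"
  by (simp add: simple_graph_def graph_components_def)

lemma component_simple_connected:
  assumes "simple_graph H" "C \<in> graph_components H"
  shows "simple_graph C" "connected_graph C"
proof -
  obtain v where v: "v \<in> verts H"
    and C: "C = induced_subgraph H {w \<in> verts H. (adjacent H)\<^sup>*\<^sup>* v w}"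
    using assms(2) by (auto simp: graph_components_def)
  show "simple_graph C"
    using assms(1) unfolding C by (auto simp: simple_graph_def induced_subgraph_def)
  \<comment> \<open>A walk from \<open>v\<close> in \<open>H\<close> never leaves the component,
    because each vertex on it is itself reachable from \<open>v\<close>.\<close>
  have from_v: "(adjacent C)\<^sup>*\<^sup>* v w" if "(adjacent H)\<^sup>*\<^sup>* v w" for w
    using that
  proof (induction rule: rtranclp_induct)
    case (step x y)
    have "adjacent C x y"
      using step.hyps simple_graph_adjacentD[OF assms(1) step.hyps(2)]
        rtranclp.rtrancl_into_rtrancl[OF step.hyps]
      by (simp add: C induced_subgraph_def adjacent_def[of _ x y])
    then show ?case using step.IH by (rule rtranclp.rtrancl_into_rtrancl[rotated])
  qed simp
  show "connected_graph C"
    unfolding connected_graph_def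
  proof (intro conjI ballI)
    show "verts C \<noteq> {}" using v by (auto simp: C induced_subgraph_def)
    fix x y assume "x \<in> verts C" "y \<in> verts C"
    then have "(adjacent C)\<^sup>*\<^sup>* v x" "(adjacent C)\<^sup>*\<^sup>* v y"
      using from_v by (auto simp: C induced_subgraph_def)
    then show "(adjacent C)\<^sup>*\<^sup>* x y" by (meson reachable_sym rtranclp_trans)
  qed
qed

text \<open>A common vertex makes the two reachability classes, and hence the induced subgraphs,
  equal.\<close>

lemma components_disjoint:
  assumes "C \<in> graph_components H" "D \<in> graph_components H" "C \<noteq> D"
  shows "verts C \<inter> verts D = {}"
proof (rule ccontr)
  assume "verts C \<inter> verts D \<noteq> {}"
  moreover obtain u v where "C = induced_subgraph H {w \<in> verts H. (adjacent H)\<^sup>*\<^sup>* u w}"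
    "D = induced_subgraph H {w \<in> verts H. (adjacent H)\<^sup>*\<^sup>* v w}"
    using assms by (auto simp: graph_components_def)
  moreover from calculation obtain x where "(adjacent H)\<^sup>*\<^sup>* u x" "(adjacent H)\<^sup>*\<^sup>* v x"
    by (auto simp: induced_subgraph_def)
  then have "(adjacent H)\<^sup>*\<^sup>* u w \<longleftrightarrow> (adjacent H)\<^sup>*\<^sup>* v w" for w
    by (meson reachable_sym rtranclp_trans)
  ultimately show False using assms(3) by simp
qed

lemma edges_eq_UN_components:
  assumes "simple_graph H"
  shows "edges H = (\<Union>C\<in>graph_components H. edges C)"
proof
  show "(\<Union>C\<in>graph_components H. edges C) \<subseteq> edges H"
    by (auto simp: graph_components_def induced_subgraph_def)
  show "edges H \<subseteq> (\<Union>C\<in>graph_components H. edges C)"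
  proof
    fix e assume e: "e \<in> edges H"
    obtain a b where ab: "e = {a, b}" "a \<in> verts H" "b \<in> verts H"
      using simple_graph_edgeE[OF assms e] .
    let ?C = "induced_subgraph H {w \<in> verts H. (adjacent H)\<^sup>*\<^sup>* a w}"
    have "adjacent H a b" using e ab by (simp add: adjacent_def)
    then have "e \<in> edges ?C" using e ab by (auto simp: induced_subgraph_def)
    moreover have "?C \<in> graph_components H" using ab by (auto simp: graph_components_def)
    ultimately show "e \<in> (\<Union>C\<in>graph_components H. edges C)" by blast
  qed
qed

text \<open>The count is a product over components, with factor |V(T)| for a tree \<open>T\<close>,
  2 for a unicyclic component and 0 for any other.\<close>

lemma card_sdrs_edges:
  assumes "simple_graph H"
  shows "card (sdrs (edges H)) = (if TU_graph H then TU_weight H else 0)"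
proof -
  let ?K = "graph_components H"
  note fin = finite_graph_components[OF assms]
  note comp = component_simple_connected[OF assms]
  have "\<Union> (edges C) \<subseteq> verts C" "{} \<notin> edges C" if "C \<in> ?K" for C
    using comp(1)[OF that] by (force simp: simple_graph_def)+
  then have "card (sdrs (\<Union>C\<in>?K. edges C)) = (\<Prod>C\<in>?K. card (sdrs (edges C)))"
    using components_disjoint[of _ H]
    by (intro card_sdrs_UNION[OF fin] pairwiseI) blast+
  then have prod: "card (sdrs (edges H)) = (\<Prod>C\<in>?K. card (sdrs (edges C)))"
    using edges_eq_UN_components[OF assms] by simp
  show ?thesis
  proof (cases "TU_graph H")
    case True
    let ?U = "{C \<in> ?K. unicyclic_graph C}" and ?T = "{C \<in> ?K. tree_graph C}"
    have K: "?K = ?U \<union> ?T" and disj: "?U \<inter> ?T = {}"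
      using True by (auto simp: TU_graph_def tree_graph_def unicyclic_graph_def)
    have "(\<Prod>C\<in>?K. card (sdrs (edges C)))
        = (\<Prod>C\<in>?U. card (sdrs (edges C))) * (\<Prod>C\<in>?T. card (sdrs (edges C)))"
      by (rule trans[OF prod.cong[OF K refl] prod.union_disjoint[OF _ _ disj]]) (use fin in auto)
    also have "\<dots> = (\<Prod>C\<in>?U. 2) * (\<Prod>C\<in>?T. card (verts C))"
      using comp card_sdrs_tree card_sdrs_unicyclic
      by (intro arg_cong2[where f = "(*)"] prod.cong) auto
    finally show ?thesis using True prod by (simp add: TU_weight_def)
  next
    case False
    then obtain C where "C \<in> ?K" "\<not> tree_graph C" "\<not> unicyclic_graph C"
      by (auto simp: TU_graph_def)
    then show ?thesis
      using False prod fin comp sdrs_connected_non_TU[of C] by (auto intro!: bexI[of _ C])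
  qed
qed

section \<open>Matchings of the subdivision\<close>

text \<open>The edge \<open>{Inl v, Inr e}\<close> records that \<open>e\<close> chooses its
  endpoint \<open>v\<close>. Disjointness at the vertices \<open>Inr e\<close> says that each
  \<open>e\<close> chooses at most once, and disjointness at the vertices \<open>Inl v\<close> says
  that the choice is injective.\<close>

lemma card_matchings_subdivision:
  assumes "simple_graph G"
  shows "card (matchings (subdivision_graph G) r)
    = (\<Sum>E\<in>{E. E \<subseteq> edges G \<and> card E = r}. card (sdrs E))"
proof -
  let ?K = "{E. E \<subseteq> edges G \<and> card E = r}"
  define m :: "'a set set \<times> ('a set \<Rightarrow> 'a) \<Rightarrow> ('a + 'a set) set set"
    where "m = (\<lambda>(E, f). (\<lambda>e. {Inl (f e), Inr e}) ` E)"
  have mem: "{Inl v, Inr e} \<in> m (E, f) \<longleftrightarrow> e \<in> E \<and> v = f e" for v e E f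
    by (auto simp: m_def doubleton_eq_iff)
  have "bij_betw m (Sigma ?K sdrs) (matchings (subdivision_graph G) r)"
    unfolding bij_betw_def
  proof
    show "inj_on m (Sigma ?K sdrs)"
    proof (rule inj_onI, clarify)
      fix E f E' f'
      assume f: "f \<in> sdrs E" "f' \<in> sdrs E'" and eq: "m (E, f) = m (E', f')"
      have *: "e \<in> E \<and> v = f e \<longleftrightarrow> e \<in> E' \<and> v = f' e" for v e
        using mem[of v e E f] mem[of v e E' f'] eq by simp
      then have "E = E'" by blast
      moreover have "f = f'"
        by (rule extensionalityI[of _ E]) (use f * \<open>E = E'\<close> in \<open>auto simp: sdrs_def PiE_def\<close>)
      ultimately show "E = E' \<and> f = f'" by simp
    qed
    show "m ` Sigma ?K sdrs = matchings (subdivision_graph G) r"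
    proof (intro equalityI subsetI)
      fix M assume "M \<in> m ` Sigma ?K sdrs"
      then obtain E f where E: "E \<subseteq> edges G" "card E = r" "f \<in> sdrs E" and M: "M = m (E, f)"
        by auto
      have "M \<subseteq> edges (subdivision_graph G)"
        using E by (auto simp: M m_def subdivision_graph_def sdrs_def PiE_def Pi_def)
      moreover have "card M = r"
        unfolding M m_def prod.case E(2)[symmetric]
        by (rule card_image) (auto simp: inj_on_def doubleton_eq_iff)
      moreover have "pairwise disjnt M"
        using E(3) by (auto simp: M m_def pairwise_def disjnt_def sdrs_def inj_on_def)
      ultimately show "M \<in> matchings (subdivision_graph G) r"
        by (simp add: matchings_def)
    next
      fix M assume "M \<in> matchings (subdivision_graph G) r"
      then have M: "M \<subseteq> edges (subdivision_graph G)" "card M = r"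
        and disj: "\<And>x y. x \<in> M \<Longrightarrow> y \<in> M \<Longrightarrow> x \<inter> y \<noteq> {} \<Longrightarrow> x = y"
        by (auto simp: matchings_def pairwise_def disjnt_def)
      \<comment> \<open>\<open>E\<close> collects the edges whose subdivision vertex is covered by
        \<open>M\<close>. The vertex that \<open>SOME\<close> picks is unique, since two matching
        edges through \<open>Inr e\<close> coincide.\<close>
      define E where "E = {e. \<exists>v. {Inl v, Inr e} \<in> M}"
      define f where "f = restrict (\<lambda>e. SOME v. {Inl v, Inr e} \<in> M) E"
      have fM: "{Inl (f e), Inr e} \<in> M" if "e \<in> E" for e
        using that someI_ex[of "\<lambda>v. {Inl v, Inr e} \<in> M"] by (simp add: E_def f_def)
      have MG: "e \<in> edges G \<and> v \<in> e" if "{Inl v, Inr e} \<in> M" for v e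
        using that M(1) by (auto simp: subdivision_graph_def doubleton_eq_iff)
      have mEf: "m (E, f) = M"
      proof
        show "m (E, f) \<subseteq> M" using fM by (auto simp: m_def)
        show "M \<subseteq> m (E, f)"
        proof
          fix x assume x: "x \<in> M"
          then obtain v e where ve: "x = {Inl v, Inr e}"
            using M(1) by (auto simp: subdivision_graph_def)
          then have "e \<in> E" using x by (auto simp: E_def)
          then show "x \<in> m (E, f)"
            using disj[OF x fM[of e]] ve by (auto simp: m_def)
        qed
      qed
      have "inj_on f E"
      proof (rule inj_onI)
        fix x y assume "x \<in> E" "y \<in> E" "f x = f y"
        \<comment> \<open>The matching edges of \<open>x\<close> and \<open>y\<close> share the
          vertex \<open>Inl (f x)\<close>.\<close>
        then show "x = y" using disj[OF fM[of x] fM[of y]] by (auto simp: doubleton_eq_iff)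
      qed
      moreover have "f \<in> (\<Pi>\<^sub>E e\<in>E. e)"
        using fM MG by (auto simp: PiE_def Pi_def f_def)
      ultimately have "f \<in> sdrs E" by (simp add: sdrs_def)
      moreover have "E \<subseteq> edges G" using fM MG by blast
      moreover have "card E = r"
        unfolding M(2)[symmetric] mEf[symmetric] m_def prod.case
        by (rule card_image[symmetric]) (auto simp: inj_on_def doubleton_eq_iff)
      ultimately show "M \<in> m ` Sigma ?K sdrs"
        using mEf by (intro image_eqI[of _ _ "(E, f)"]) auto
    qed
  qed
  then have "card (matchings (subdivision_graph G) r) = card (Sigma ?K sdrs)"
    by (simp add: bij_betw_same_card)
  also have "\<dots> = (\<Sum>E\<in>?K. card (sdrs E))"
    using simple_graph_finite_edges[OF assms] finite_sdrs[OF assms] by (intro card_SigmaI) auto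
  finally show ?thesis .
qed

theorem theorem2p5:
  fixes G :: "'a ugraph" and r :: nat
  assumes "simple_graph G"
  shows "matching_count (subdivision_graph G) r = (\<Sum>H\<in>TU_subgraphs G r. TU_weight H)"
proof -
  let ?K = "{E. E \<subseteq> edges G \<and> card E = r}"
  \<comment> \<open>The edge-induced subgraph of an edge set; \<open>edges\<close> is a left inverse
    of \<open>ind\<close>, so the sum over subgraphs can be reindexed by edge sets.\<close>
  define ind :: "'a set set \<Rightarrow> 'a ugraph" where "ind E = \<lparr>verts = \<Union> E, edges = E\<rparr>" for E
  have edges_ind: "edges (ind E) = E" for E by (simp add: ind_def)
  have sub: "subgraph_of (ind E) G" if "E \<subseteq> edges G" for E
    using assms that
    by (auto simp: subgraph_of_def simple_graph_def ind_def intro!: finite_subset[of "\<Union> E" "verts G"])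
  have TU: "TU_subgraphs G r = ind ` {E \<in> ?K. TU_graph (ind E)}"
  proof (intro equalityI subsetI)
    fix H assume H: "H \<in> TU_subgraphs G r"
    then have "H = ind (edges H)" by (simp add: TU_subgraphs_def ind_def)
    with H show "H \<in> ind ` {E \<in> ?K. TU_graph (ind E)}"
      by (intro image_eqI[of _ _ "edges H"]) (auto simp: TU_subgraphs_def subgraph_of_def)
  next
    fix H assume "H \<in> ind ` {E \<in> ?K. TU_graph (ind E)}"
    then show "H \<in> TU_subgraphs G r"
      using sub by (auto simp: TU_subgraphs_def ind_def)
  qed
  have inj: "inj_on ind A" for A
    by (metis edges_ind inj_onI)
  have "matching_count (subdivision_graph G) r = (\<Sum>E\<in>?K. card (sdrs E))"
    by (simp add: matching_count_def card_matchings_subdivision[OF assms])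
  also have "\<dots> = (\<Sum>E\<in>?K. if TU_graph (ind E) then TU_weight (ind E) else 0)"
    using card_sdrs_edges[of "ind _"] sub
    by (intro sum.cong) (auto simp: edges_ind subgraph_of_def)
  \<comment> \<open>Edge sets that do not span a TU-subgraph contribute 0 and drop out.\<close>
  also have "\<dots> = (\<Sum>E\<in>{E \<in> ?K. TU_graph (ind E)}. TU_weight (ind E))"
    using simple_graph_finite_edges[OF assms] by (intro sum.inter_filter[symmetric]) auto
  also have "\<dots> = (\<Sum>H\<in>TU_subgraphs G r. TU_weight H)"
    unfolding TU by (simp add: sum.reindex[OF inj])
  finally show ?thesis .
qed

end
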